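(* Let $G$ be an undirected graph on $n$ vertices, let $b$ be a positive integer, let $\eta>0$, and let $G^b$ be the multigraph obtained from $G$ by replacing every edge by $b$ parallel copies. Let $\rho_b$ denote the maximum subgraph density of $G^b$. Let $\overrightarrow{G}^b$ be any orientation of $G^b$ such that, for some constant $c\ge 0$, every directed edge $\overrightarrow{uv}$ of $\overrightarrow{G}^b$ satisfies $d^+(u) \le (1+\eta b^{-1})\, d^+(v) + c$. Then for any constant $\gamma>0$ there exists a value $k_{\max} \le \log_{1+\gamma} n$ such that \[ (1+\eta b^{-1})^{-k_{\max}}\,\Delta(\overrightarrow{G}^b) \le (1+\gamma)\rho_b + c(\eta^{-1} b + 1). \]
   Context: For a (multi)graph $H=(V,E)$, the maximum subgraph density is $\max_{\emptyset\ne S\subseteq V} |E(S)|/|S|$, where $E(S)$ is the multiset of edges with both endpoints in $S$. An orientation assigns a direction to each edge (each parallel copy separately). $d^+(u)$ is the out-degree of $u$ (number of edge copies directed out of $u$, counted with multiplicity), and $\Delta(\overrightarrow{H}) = \max_{v} d^+(v)$ is the maximum out-degree of the orientation. *)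

theory Defs
  imports Complex_Main "HOL-Library.Multiset"
begin

definition simple_graph :: "'a set \<Rightarrow> 'a set set \<Rightarrow> bool" where
  "simple_graph V E \<longleftrightarrow> finite V \<and> (\<forall>e\<in>E. e \<subseteq> V \<and> card e = 2)"

text \<open>A multigraph is given by a vertex set and a multiset of edges, each edge being the set of its
  endpoints; the count of an edge is its number of parallel copies.\<close>

definition edge_copies :: "nat \<Rightarrow> 'a set set \<Rightarrow> 'a set multiset" where
  "edge_copies b E = repeat_mset b (mset_set E)"

definition edges_within :: "'a set multiset \<Rightarrow> 'a set \<Rightarrow> 'a set multiset" where
  "edges_within M S = {#e \<in># M. e \<subseteq> S#}"

text \<open>Only meaningful for finite nonempty \<open>V\<close>, since \<open>Max\<close> of an empty or infinite set is
  unspecified; the same applies to \<open>max_out_degree\<close>.\<close>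

definition max_subgraph_density :: "'a set \<Rightarrow> 'a set multiset \<Rightarrow> real" where
  "max_subgraph_density V M =
     Max ((\<lambda>S. real (size (edges_within M S)) / real (card S)) ` {S. S \<subseteq> V \<and> S \<noteq> {}})"

text \<open>Parallel copies are indistinguishable, so directing each copy separately amounts to choosing a
  multiset of arcs whose underlying multiset of undirected edges is \<open>M\<close>. The pair \<open>(u, v)\<close> is an
  arc directed from \<open>u\<close> to \<open>v\<close>.\<close>

definition orientation :: "'a set multiset \<Rightarrow> ('a \<times> 'a) multiset \<Rightarrow> bool" where
  "orientation M D \<longleftrightarrow> image_mset (\<lambda>(u, v). {u, v}) D = M"

definition out_degree :: "('a \<times> 'a) multiset \<Rightarrow> 'a \<Rightarrow> nat" where
  "out_degree D u = size {#a \<in># D. fst a = u#}"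

definition max_out_degree :: "'a set \<Rightarrow> ('a \<times> 'a) multiset \<Rightarrow> nat" where
  "max_out_degree V D = Max (out_degree D ` V)"

end

theory Submission
  imports Defs
begin

text \<open>Put \<open>q = 1 + \<eta> / b\<close>, \<open>A = c b / \<eta>\<close>, and let \<open>S\<^sub>k\<close> be the set of vertices of out-degree at least
  \<open>T\<^sub>k = (\<Delta> + A) / q\<^sup>k - A\<close>. The thresholds satisfy \<open>q T\<^sub>k\<^sub>+\<^sub>1 + c = T\<^sub>k\<close>, so the local condition on the
  orientation sends every arc leaving \<open>S\<^sub>k\<close> into \<open>S\<^sub>k\<^sub>+\<^sub>1\<close>, and \<open>S\<^sub>k\<^sub>+\<^sub>1\<close> spans at least \<open>T\<^sub>k |S\<^sub>k|\<close> edges.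
  The sets cannot grow by a factor \<open>1 + \<gamma>\<close> more than \<open>log\<^bsub>1+\<gamma>\<^esub> n\<close> times in a row; at the first \<open>k\<close>
  where the growth fails, the density of \<open>S\<^sub>k\<^sub>+\<^sub>1\<close> is at least \<open>T\<^sub>k / (1 + \<gamma>)\<close>.\<close>

lemma size_filter_fst_eq_sum_out_degree:
  assumes "finite S"
  shows "size {#a \<in># D. fst a \<in> S#} = (\<Sum>u\<in>S. out_degree D u)"
proof (induction D)
  case empty
  show ?case by (simp add: out_degree_def)
next
  case (add a D)
  have "(\<Sum>u\<in>S. out_degree (add_mset a D) u)
      = (\<Sum>u\<in>S. out_degree D u + (if fst a = u then 1 else 0))"
    by (intro sum.cong) (auto simp: out_degree_def)
  also have "\<dots> = (\<Sum>u\<in>S. out_degree D u) + (if fst a \<in> S then 1 else 0)"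
    using assms by (simp add: sum.distrib)
  finally show ?case using add by simp
qed

text \<open>The sum counts the arcs with tail in \<open>S\<close>. Each has both ends in
  \<open>S'\<close>, and forgetting directions turns \<open>D\<close> into \<open>M\<close> copy by
  copy, so multiplicities survive and no edge copy is counted twice.\<close>

lemma sum_out_degree_le_size_edges_within:
  assumes "orientation M D" and "finite S"
    and "\<And>u v. (u, v) \<in># D \<Longrightarrow> u \<in> S \<Longrightarrow> u \<in> S' \<and> v \<in> S'"
  shows "(\<Sum>u\<in>S. out_degree D u) \<le> size (edges_within M S')"
proof -
  have "{#a \<in># D. fst a \<in> S#} \<subseteq># {#a \<in># D. {fst a, snd a} \<subseteq> S'#}"
    using assms(3) by (intro mset_subset_eqI) (force simp: not_in_iff)
  then have "size {#a \<in># D. fst a \<in> S#} \<le> size {#a \<in># D. {fst a, snd a} \<subseteq> S'#}"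
    by (rule size_mset_mono)
  also have "\<dots> = size (edges_within M S')"
    using assms(1)
    by (auto simp: edges_within_def orientation_def filter_mset_image_mset o_def case_prod_beta)
  finally show ?thesis
    using size_filter_fst_eq_sum_out_degree[OF assms(2)] by simp
qed

lemma density_le_max_subgraph_density:
  assumes "finite V" and "S \<subseteq> V" and "S \<noteq> {}"
  shows "real (size (edges_within M S)) / real (card S) \<le> max_subgraph_density V M"
  unfolding max_subgraph_density_def using assms by (intro Max_ge) auto

lemma orientation_edge_copies_in_vertices:
  assumes "simple_graph V E" and "orientation (edge_copies b E) D" and "(u, v) \<in># D"
  shows "u \<in> V" and "v \<in> V"
proof -
  have "{u, v} \<in># image_mset (\<lambda>(u, v). {u, v}) D"
    using assms(3) by force
  then have "{u, v} \<in># edge_copies b E"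
    using assms(2) by (simp only: orientation_def)
  then have "{u, v} \<in> E"
    by (simp add: edge_copies_def count_mset_set' flip: count_greater_zero_iff split: if_splits)
  then have "{u, v} \<subseteq> V"
    using assms(1) unfolding simple_graph_def by blast
  then show "u \<in> V" and "v \<in> V" by auto
qed

text \<open>Take the least \<open>k\<close> at which growth by the factor
  \<open>1 + \<gamma>\<close> fails. All earlier steps multiply, so
  \<open>(1 + \<gamma>) ^ k \<le> f k \<le> N\<close>, and taking logarithms bounds
  \<open>k\<close>.\<close>

lemma exists_slow_growth_step:
  fixes f :: "nat \<Rightarrow> real"
  assumes "\<gamma> > 0" and "f 0 \<ge> 1" and "\<And>k. f k \<le> N"
  shows "\<exists>k. real k \<le> log (1 + \<gamma>) N \<and> f (Suc k) < (1 + \<gamma>) * f k"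
proof -
  have growth: "(1 + \<gamma>) ^ k \<le> f k" if "\<And>i. i < k \<Longrightarrow> (1 + \<gamma>) * f i \<le> f (Suc i)" for k
    using that
  proof (induction k)
    case 0
    show ?case using assms(2) by simp
  next
    case (Suc k)
    have "(1 + \<gamma>) ^ Suc k \<le> (1 + \<gamma>) * f k"
      using Suc assms(1) by simp
    also have "\<dots> \<le> f (Suc k)"
      using Suc.prems by simp
    finally show ?case .
  qed
  \<comment> \<open>Some step must fail: otherwise \<open>f m\<close> would be at least
    \<open>(1 + \<gamma>) ^ m\<close>, which exceeds \<open>N\<close>.\<close>
  obtain m where "N < (1 + \<gamma>) ^ m"
    using real_arch_pow[of "1 + \<gamma>" N] assms(1) by auto
  then have "\<exists>k. f (Suc k) < (1 + \<gamma>) * f k"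
    using growth[of m] assms(3)[of m] by (meson leI le_less_trans not_less)
  then obtain k where k: "f (Suc k) < (1 + \<gamma>) * f k"
    and least: "\<And>i. i < k \<Longrightarrow> (1 + \<gamma>) * f i \<le> f (Suc i)"
    using exists_least_iff[of "\<lambda>k. f (Suc k) < (1 + \<gamma>) * f k"] by (auto simp: not_less)
  have "(1 + \<gamma>) ^ k \<le> N"
    using growth[of k] least assms(3)[of k] by (meson order_trans)
  then have "real k \<le> log (1 + \<gamma>) N"
    using assms(1) by (intro le_log_of_power) auto
  with k show ?thesis by blast
qed

theorem theorem1:
  fixes V :: "'a set" and E :: "'a set set" and D :: "('a \<times> 'a) multiset"
    and n b :: nat and \<eta> c \<gamma> :: real
  assumes "simple_graph V E" and "V \<noteq> {}" and "card V = n"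
    and "b > 0" and "\<eta> > 0" and "c \<ge> 0"
    and "orientation (edge_copies b E) D"
    and "\<And>u v. (u, v) \<in># D \<Longrightarrow>
           real (out_degree D u) \<le> (1 + \<eta> / real b) * real (out_degree D v) + c"
    and "\<gamma> > 0"
  shows "\<exists>k_max :: nat. real k_max \<le> log (1 + \<gamma>) (real n) \<and>
           (1 + \<eta> / real b) powr (- real k_max) * real (max_out_degree V D)
             \<le> (1 + \<gamma>) * max_subgraph_density V (edge_copies b E) + c * (real b / \<eta> + 1)"
proof -
  define q where "q = 1 + \<eta> / real b"
  \<comment> \<open>The value \<open>- A\<close> is the fixed point of the map taking x to q x + c.
    Shifting by \<open>A\<close> makes the recursion for the thresholds purely geometric.\<close>
  define A where "A = c * real b / \<eta>"
  define \<Delta> where "\<Delta> = real (max_out_degree V D)"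
  define T where "T k = (\<Delta> + A) / q ^ k - A" for k
  define S where "S k = {v \<in> V. T k \<le> real (out_degree D v)}" for k
  define \<rho> where "\<rho> = max_subgraph_density V (edge_copies b E)"
  have finV: "finite V" using assms(1) by (simp add: simple_graph_def)
  have q: "q > 1" using assms(4,5) by (simp add: q_def)
  have A: "A \<ge> 0" using assms(5,6) by (simp add: A_def)
  have qA: "q * A = A + c" using assms(4,5) by (simp add: q_def A_def field_simps)
  have \<Delta>: "\<Delta> \<ge> 0" by (simp add: \<Delta>_def)
  have T_step: "q * T (Suc k) + c = T k" for k
    using q qA by (simp add: T_def right_diff_distrib)
  have T_antimono: "T (Suc k) \<le> T k" for k
    using q A \<Delta> by (auto simp: T_def intro!: divide_left_mono)
  \<comment> \<open>An arc counted in \<open>S (Suc k)\<close> needs both ends there: the local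
    condition places its head, this inclusion its tail.\<close>
  have S_mono: "S k \<subseteq> S (Suc k)" for k
    using T_antimono[of k] by (auto simp: S_def)
  have S_fin: "finite (S k)" and S_V: "S k \<subseteq> V" for k
    using finV by (auto simp: S_def)
  \<comment> \<open>Since \<open>T 0 = \<Delta>\<close>, a vertex attaining the maximum out-degree
    lies in \<open>S 0\<close>.\<close>
  have "max_out_degree V D \<in> out_degree D ` V"
    unfolding max_out_degree_def using finV assms(2) by (intro Max_in) auto
  then have "S 0 \<noteq> {}" by (auto simp: S_def T_def \<Delta>_def)
  then have S_ne: "S k \<noteq> {}" for k
    using S_mono by (induction k) auto
  have "card (S 0) \<ge> 1"
    using S_ne[of 0] S_fin[of 0] by (simp add: Suc_le_eq card_gt_0_iff)
  moreover have "card (S k) \<le> n" for k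
    using card_mono[OF finV S_V] assms(3) by simp
  ultimately obtain k where k: "real k \<le> log (1 + \<gamma>) (real n)"
    and slow: "real (card (S (Suc k))) < (1 + \<gamma>) * real (card (S k))"
    using exists_slow_growth_step[of \<gamma> "\<lambda>k. real (card (S k))" "real n"] assms(9) by auto
  have out: "u \<in> S (Suc k) \<and> v \<in> S (Suc k)" if "(u, v) \<in># D" and "u \<in> S k" for u v
  proof -
    have "q * T (Suc k) + c \<le> real (out_degree D u)"
      using that(2) T_step by (simp add: S_def)
    also have "\<dots> \<le> q * real (out_degree D v) + c"
      using assms(8)[OF that(1)] by (simp add: q_def)
    finally have "T (Suc k) \<le> real (out_degree D v)" using q by simp
    then show ?thesis
      using orientation_edge_copies_in_vertices[OF assms(1,7) that(1)] S_mono that(2)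
      by (auto simp: S_def)
  qed
  let ?m = "real (size (edges_within (edge_copies b E) (S (Suc k))))"
  have card_pos: "real (card (S (Suc k))) > 0"
    using S_ne S_fin by (simp add: card_gt_0_iff)
  have dens: "?m / real (card (S (Suc k))) \<le> \<rho>"
    unfolding \<rho>_def by (rule density_le_max_subgraph_density[OF finV S_V S_ne])
  \<comment> \<open>The sign of \<open>\<rho>\<close> allows the bound \<open>slow\<close> to be
    multiplied by it below.\<close>
  then have \<rho>: "\<rho> \<ge> 0"
    by (rule order_trans[rotated]) simp
  have "real (card (S k)) * T k = (\<Sum>u\<in>S k. T k)" by simp
  also have "\<dots> \<le> (\<Sum>u\<in>S k. real (out_degree D u))"
    by (intro sum_mono) (simp add: S_def)
  also have "\<dots> \<le> ?m"
    using sum_out_degree_le_size_edges_within[OF assms(7) S_fin out]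
    by (simp flip: of_nat_sum)
  also have "\<dots> \<le> \<rho> * real (card (S (Suc k)))"
    using dens card_pos by (simp add: divide_le_eq)
  also have "\<dots> \<le> \<rho> * ((1 + \<gamma>) * real (card (S k)))"
    using slow \<rho> by (intro mult_left_mono) auto
  finally have "real (card (S k)) * T k \<le> real (card (S k)) * ((1 + \<gamma>) * \<rho>)"
    by (simp add: ac_simps)
  moreover have "real (card (S k)) > 0"
    using S_ne S_fin by (simp add: card_gt_0_iff)
  ultimately have T_le: "T k \<le> (1 + \<gamma>) * \<rho>" by simp
  have "q powr (- real k) * \<Delta> = \<Delta> / q ^ k"
    using q by (simp add: powr_minus powr_realpow divide_inverse)
  \<comment> \<open>Adding \<open>A / q ^ k\<close> completes the expression to
    \<open>T k + A\<close>; the remaining \<open>A\<close> is absorbed by the additive term, which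
    equals \<open>A + c\<close>.\<close>
  also have "\<dots> \<le> (\<Delta> + A) / q ^ k"
    using q A by (intro divide_right_mono) auto
  also have "\<dots> = T k + A" by (simp add: T_def)
  also have "\<dots> \<le> (1 + \<gamma>) * \<rho> + c * (real b / \<eta> + 1)"
    using T_le assms(6) by (simp add: A_def algebra_simps)
  finally show ?thesis using k unfolding q_def \<Delta>_def \<rho>_def by blast
qed

end
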